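(* Let $m,n\geq 1$ be integers and let $k$ be an integer with $1\leq k\leq n$. Then $$\sum_{l_{1},\dots,l_{m-1}=0}^{n}\left\vert S_{1}(n,l_{1})S_{1}(l_{1},l_{2})\cdots S_{1}(l_{m-1},k)\right\vert =\sum_{\substack{k_{1}+\cdots+k_{m}=n-k\\ k_1,\dots,k_m\geq 0}}(-1)^{k_{1}+\cdots+k_{m}}\binom{n-1}{k_{1},\dots,k_{m},k-1}\prod_{i=1}^{m}B^{(n-k_{m}-k_{m-1}-\cdots-k_{i+1})}_{k_{i}},$$ i.e. the product on the right is $B^{(n)}_{k_{m}}B^{(n-k_{m})}_{k_{m-1}}\cdots B^{(n-k_{m}-\cdots-k_{2})}_{k_1}$.
   Context: $S_1(n,k)$ denotes the Stirling numbers of the first kind, defined by $(x)_n=x(x-1)\cdots(x-n+1)=\sum_{k=0}^{n}S_1(n,k)x^k$, with $S_1(i,j)=0$ for $j>i$. For $m=1$ the left-hand side has no summation indices and is to be read as $|S_1(n,k)|$. For $\alpha\in\mathbb{R}$, the Bernoulli numbers of order $\alpha$ are $B^{(\alpha)}_n=B^{(\alpha)}_n(0)$, where $\left(\frac{t}{e^t-1}\right)^{\alpha}e^{xt}=\sum_{n\geq 0}B^{(\alpha)}_n(x)\frac{t^n}{n!}$. The multinomial coefficient is $\binom{n-1}{k_1,\dots,k_m,k-1}=\frac{(n-1)!}{k_1!\cdots k_m!\,(k-1)!}$. *)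

theory Defs
  imports
    "HOL-Computational_Algebra.Computational_Algebra"
    "HOL-Library.FuncSet"
begin

definition falling_fact_poly :: "nat \<Rightarrow> int poly" where
  "falling_fact_poly n = (\<Prod>i<n. [:- int i, 1:])"

text \<open>The signed Stirling numbers of the first kind.\<close>

definition S1 :: "nat \<Rightarrow> nat \<Rightarrow> int" where
  "S1 n k = coeff (falling_fact_poly n) k"

lemma poly_falling_fact_poly: "poly (falling_fact_poly n) x = (\<Prod>i<n. x - int i)"
  by (simp add: falling_fact_poly_def poly_prod)

lemma degree_falling_fact_poly: "degree (falling_fact_poly n) = n"
  unfolding falling_fact_poly_def
  by (subst degree_prod_eq_sum_degree) simp_all

lemma falling_fact_eq_sum_S1: "(\<Prod>i<n. x - int i) = (\<Sum>k=0..n. S1 n k * x ^ k)"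
  using poly_altdef[of "falling_fact_poly n" x]
  by (simp add: poly_falling_fact_poly degree_falling_fact_poly S1_def atMost_atLeast0)

lemma S1_eq_0: "n < k \<Longrightarrow> S1 n k = 0"
  by (simp add: S1_def coeff_eq_0 degree_falling_fact_poly)

text \<open>
  The power of a formal power series with a real exponent, via the binomial series
  \<open>F\<^sup>a = (1 + (F - 1))\<^sup>a\<close>. It is only meaningful if the constant term of \<open>F\<close> is \<open>1\<close>.
\<close>

definition fps_real_power :: "real fps \<Rightarrow> real \<Rightarrow> real fps" where
  "fps_real_power F a = fps_binomial a oo (F - 1)"

lemma fps_real_power_of_nat:
  assumes "F $ 0 = 1"
  shows "fps_real_power F (real n) = F ^ n"
  using assms
  by (simp add: fps_real_power_def fps_binomial_of_nat fps_compose_add_distrib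
      flip: fps_compose_power)

lemma fps_real_power_add:
  assumes "F $ 0 = 1"
  shows "fps_real_power F (a + b) = fps_real_power F a * fps_real_power F b"
  using assms
  by (simp add: fps_real_power_def fps_binomial_add_mult fps_compose_mult_distrib)

text \<open>The series of \<open>t / (e\<^sup>t - 1)\<close>.\<close>

definition bernoulli_fps :: "real fps" where
  "bernoulli_fps = fps_X / (fps_exp 1 - 1)"

lemma bernoulli_fps_mult: "bernoulli_fps * (fps_exp 1 - 1) = fps_X"
proof -
  have "(fps_exp 1 - 1 :: real fps) \<noteq> 0"
  proof
    assume "(fps_exp 1 - 1 :: real fps) = 0"
    then have "(fps_exp 1 - 1 :: real fps) $ 1 = 0 $ 1" by simp
    then show False by simp
  qed
  moreover have "subdegree (fps_exp 1 - 1 :: real fps) = 1"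
    by (rule subdegreeI) auto
  ultimately show ?thesis
    unfolding bernoulli_fps_def
    by (intro dvd_div_mult_self) (simp add: fps_dvd_iff)
qed

lemma bernoulli_fps_nth_0: "bernoulli_fps $ 0 = 1"
proof -
  have "(bernoulli_fps * (fps_exp 1 - 1)) $ 1 = 1"
    by (simp add: bernoulli_fps_mult)
  then show ?thesis by (simp add: fps_mult_nth)
qed

definition bernoulli_poly :: "real \<Rightarrow> nat \<Rightarrow> real \<Rightarrow> real" where
  "bernoulli_poly a n x = fact n * (fps_real_power bernoulli_fps a * fps_exp x) $ n"

definition bernoulli_num :: "real \<Rightarrow> nat \<Rightarrow> real" where
  "bernoulli_num a n = bernoulli_poly a n 0"

text \<open>
  For \<open>l\<^sub>1, \<dots>, l\<^sub>m\<^sub>-\<^sub>1\<close> given as a function \<open>l\<close>, the product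
  \<open>S1 n l\<^sub>1 * S1 l\<^sub>1 l\<^sub>2 * \<dots> * S1 l\<^sub>m\<^sub>-\<^sub>1 k\<close>; the endpoints are put in as \<open>l\<^sub>0 = n\<close> and \<open>l\<^sub>m = k\<close>,
  so that the product is \<open>S1 n k\<close> for \<open>m = 1\<close>.
\<close>

definition S1_chain :: "nat \<Rightarrow> nat \<Rightarrow> nat \<Rightarrow> (nat \<Rightarrow> nat) \<Rightarrow> int" where
  "S1_chain m n k l = (let l' = l(0 := n, m := k) in \<Prod>i<m. S1 (l' i) (l' (Suc i)))"

text \<open>Tuples \<open>(k\<^sub>1, \<dots>, k\<^sub>m)\<close> of natural numbers with sum \<open>N\<close>.\<close>

definition weak_compositions :: "nat \<Rightarrow> nat \<Rightarrow> (nat \<Rightarrow> nat) set" where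
  "weak_compositions m N = {\<kappa> \<in> {1..m} \<rightarrow>\<^sub>E UNIV. (\<Sum>i=1..m. \<kappa> i) = N}"

lemma finite_weak_compositions: "finite (weak_compositions m N)"
proof (rule finite_subset)
  show "weak_compositions m N \<subseteq> {1..m} \<rightarrow>\<^sub>E {0..N}"
  proof
    fix \<kappa> assume \<kappa>: "\<kappa> \<in> weak_compositions m N"
    have "\<kappa> i \<le> N" if "i \<in> {1..m}" for i
      using member_le_sum[of i "{1..m}" \<kappa>] that \<kappa> by (simp add: weak_compositions_def)
    with \<kappa> show "\<kappa> \<in> {1..m} \<rightarrow>\<^sub>E {0..N}"
      by (auto simp: weak_compositions_def PiE_iff)
  qed
qed (intro finite_PiE; simp)

text \<open>
  The multinomial coefficient \<open>(n - 1)! / (k\<^sub>1! \<dots> k\<^sub>m! (k - 1)!)\<close>; natural number subtraction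
  is harmless since it is used for \<open>n, k \<ge> 1\<close> only.
\<close>

definition multinom :: "nat \<Rightarrow> nat \<Rightarrow> nat \<Rightarrow> (nat \<Rightarrow> nat) \<Rightarrow> real" where
  "multinom m n k \<kappa> = fact (n - 1) / ((\<Prod>i=1..m. fact (\<kappa> i)) * fact (k - 1))"

end

(* With G = t / (e^t - 1), the equation t G' = G - G^2 - t G gives a recurrence in n for the
   coefficients of G^n.  It matches S1(n+1,k) = S1(n,k-1) - n S1(n,k), whence
   S1(n,k) = (n-1)!/(k-1)! [t^(n-k)] G^n.  In a nonzero summand on the left, the chain
   n >= l_1 >= ... >= l_(m-1) >= k is weakly decreasing, and its increments, read from the end,
   form a weak composition of n - k; the quotients of factorials telescope to the multinomial
   coefficient. *)
theory Submission
  imports Defs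
begin

section \<open>Recurrence and signs of the Stirling numbers\<close>

lemma S1_0: "S1 0 k = (if k = 0 then 1 else 0)"
  by (simp add: S1_def falling_fact_poly_def)

lemma falling_fact_poly_Suc:
  "falling_fact_poly (Suc n) = falling_fact_poly n * [:- int n, 1:]"
  by (simp add: falling_fact_poly_def mult.commute)

lemma S1_Suc_0: "S1 (Suc n) 0 = - int n * S1 n 0"
  by (simp add: S1_def falling_fact_poly_Suc)

lemma S1_Suc_Suc: "S1 (Suc n) (Suc k) = S1 n k - int n * S1 n (Suc k)"
  by (simp add: S1_def falling_fact_poly_Suc)

lemma S1_pos_0: "n > 0 \<Longrightarrow> S1 n 0 = 0"
proof (induction n)
  case (Suc n)
  then show ?case by (cases n) (simp_all add: S1_Suc_0)
qed simp

text \<open>Multiplying the recurrence by the sign turns its minus into a plus, so nonnegativity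
  passes from \<open>n\<close> to \<open>Suc n\<close>.\<close>

lemma S1_sign_nonneg: "(-1) ^ (n + k) * S1 n k \<ge> 0"
proof (induction n arbitrary: k)
  case 0
  show ?case by (simp add: S1_0)
next
  case (Suc n)
  show ?case
  proof (cases k)
    case 0
    have "(-1) ^ (Suc n + 0) * S1 (Suc n) 0 = int n * ((-1) ^ (n + 0) * S1 n 0)"
      by (simp add: S1_Suc_0)
    then show ?thesis using Suc.IH[of 0] 0 by simp
  next
    case (Suc j)
    have "(-1) ^ (Suc n + Suc j) * S1 (Suc n) (Suc j)
        = (-1) ^ (n + j) * S1 n j + int n * ((-1) ^ (n + Suc j) * S1 n (Suc j))"
      by (simp add: S1_Suc_Suc algebra_simps)
    also have "\<dots> \<ge> 0"
      by (intro add_nonneg_nonneg mult_nonneg_nonneg Suc.IH of_nat_0_le_iff)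
    finally show ?thesis using Suc by simp
  qed
qed

lemma abs_S1: "\<bar>S1 n k\<bar> = (-1) ^ (n + k) * S1 n k"
proof -
  have "\<bar>S1 n k\<bar> = \<bar>(-1) ^ (n + k) * S1 n k\<bar>"
    by (simp add: abs_mult power_abs)
  then show ?thesis using S1_sign_nonneg[of n k] by simp
qed

section \<open>The series t / (e^t - 1) and the coefficients of its powers\<close>

lemma bernoulli_fps_ode:
  "fps_X * fps_deriv bernoulli_fps
     = bernoulli_fps - bernoulli_fps ^ 2 - fps_X * bernoulli_fps"
proof -
  define G where "G = bernoulli_fps"
  define E where "E = (fps_exp 1 :: real fps)"
  have GE: "G * (E - 1) = fps_X"
    unfolding G_def E_def by (rule bernoulli_fps_mult)
  have "fps_deriv (G * (E - 1)) = 1"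
    unfolding GE by simp
  then have dG: "fps_deriv G * (E - 1) = 1 - G * E"
    by (simp add: E_def eq_diff_eq add.commute)
  \<comment> \<open>Writing t as \<open>G * (E - 1)\<close> supplies the factor \<open>E - 1\<close>
    that \<open>dG\<close> asks for, so nothing has to be divided. Afterwards \<open>G * E\<close>
    is split as \<open>G * (E - 1) + G\<close>, that is, t + G.\<close>
  have "fps_X * fps_deriv G = G * (fps_deriv G * (E - 1))"
    unfolding GE[symmetric] by (simp add: mult_ac)
  also have "\<dots> = G * (1 - G * E)"
    unfolding dG ..
  also have "\<dots> = G - G ^ 2 - (G * (E - 1)) * G"
    by (simp add: algebra_simps power2_eq_square)
  finally show ?thesis
    unfolding GE by (simp add: G_def)
qed

text \<open>By the chain rule, t (G^n)' = n G^(n-1) t G'. The term - G^2 in t G' raises the exponent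
  to n + 1, and the equation is solved for it.\<close>

lemma bernoulli_fps_power_ode:
  "of_nat n * bernoulli_fps ^ Suc n =
     of_nat n * bernoulli_fps ^ n - fps_X * fps_deriv (bernoulli_fps ^ n)
       - of_nat n * (fps_X * bernoulli_fps ^ n)"
proof (cases n)
  case (Suc p)
  define G where "G = bernoulli_fps"
  have "fps_X * fps_deriv (G ^ n) = of_nat n * (G ^ p * (fps_X * fps_deriv G))"
    by (simp only: fps_deriv_power' Suc diff_Suc_1 mult_ac)
  also have "\<dots> = of_nat n * (G ^ p * (G - G ^ 2 - fps_X * G))"
    unfolding G_def bernoulli_fps_ode ..
  also have "\<dots> = of_nat n * G ^ n - of_nat n * G ^ Suc n - of_nat n * (fps_X * G ^ n)"
    by (simp add: Suc algebra_simps power2_eq_square)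
  finally show ?thesis by (simp add: G_def)
qed simp

lemma bernoulli_fps_power_nth_0: "(bernoulli_fps ^ n) $ 0 = 1"
  by (simp add: fps_power_zeroth bernoulli_fps_nth_0)

text \<open>Comparison of coefficients at t^(j+1): t d/dt multiplies the coefficient by j + 1, and
  the factor t shifts the index to j.\<close>

lemma bernoulli_fps_power_Suc_nth_Suc:
  "real n * (bernoulli_fps ^ Suc n) $ Suc j =
     (real n - real (Suc j)) * (bernoulli_fps ^ n) $ Suc j - real n * (bernoulli_fps ^ n) $ j"
proof -
  have "(of_nat n * bernoulli_fps ^ Suc n) $ Suc j =
      (of_nat n * bernoulli_fps ^ n - fps_X * fps_deriv (bernoulli_fps ^ n)
       - of_nat n * (fps_X * bernoulli_fps ^ n)) $ Suc j"
    by (rule arg_cong[OF bernoulli_fps_power_ode])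
  then show ?thesis
    by (simp add: fps_of_nat[symmetric] algebra_simps del: power_Suc)
qed

text \<open>Induction on \<open>n\<close>: multiplied by (n-1)!/j!, the coefficient recurrence
  becomes the recurrence for \<open>S1 (Suc n) (Suc j)\<close>. Treated apart are
  \<open>n = 0\<close>, where n! = n (n-1)! fails, and \<open>j = n\<close>, where only the constant
  coefficient 1 occurs.\<close>

lemma S1_eq_bernoulli_fps_nth:
  assumes "1 \<le> k" "k \<le> n"
  shows "real_of_int (S1 n k) = fact (n - 1) / fact (k - 1) * (bernoulli_fps ^ n) $ (n - k)"
  using assms
proof (induction n arbitrary: k)
  case (Suc n)
  note g0 = bernoulli_fps_power_nth_0
  obtain j where k: "k = Suc j" using Suc.prems by (cases k) auto
  show ?case
  proof (cases "n = 0")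
    case True
    with Suc.prems k show ?thesis
      by (simp add: S1_Suc_Suc S1_0 bernoulli_fps_nth_0)
  next
    case n: False
    have fact_n: "fact n = real n * fact (n - 1)" using n by (simp add: fact_reduce)
    consider "j = n" | "j < n" using Suc.prems k by linarith
    then show ?thesis
    proof cases
      case 1
      with n Suc.IH[of n] show ?thesis
        by (simp add: k S1_Suc_Suc S1_eq_0 g0 fact_n bernoulli_fps_nth_0)
    next
      case 2
      define i where "i = n - Suc j"
      have i: "n - j = Suc i" "n = Suc j + i" using 2 by (auto simp: i_def)
      have IH1: "real_of_int (S1 n (Suc j)) = fact (n - 1) / fact j * (bernoulli_fps ^ n) $ i"
        using Suc.IH[of "Suc j"] 2 by (simp add: i_def)
      \<comment> \<open>For positive \<open>j\<close> the factor \<open>real j\<close> turns 1/j!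
        into the 1/(j-1)! of the induction hypothesis. At \<open>j = 0\<close>, which that
        hypothesis does not cover, it makes the right side vanish, as \<open>S1 n 0\<close> does for
        positive \<open>n\<close>.\<close>
      have IH0: "real_of_int (S1 n j)
          = fact (n - 1) / fact j * (real j * (bernoulli_fps ^ n) $ Suc i)"
      proof (cases "j = 0")
        case True
        with n show ?thesis by (simp add: S1_pos_0)
      next
        case False
        with Suc.IH[of j] 2 i show ?thesis
          by (simp add: fact_reduce[of j] field_simps)
      qed
      have nj: "real n - real (Suc i) = real j" using i(2) by simp
      have "fact n / fact j * (bernoulli_fps ^ Suc n) $ Suc i
          = fact (n - 1) / fact j * (real n * (bernoulli_fps ^ Suc n) $ Suc i)"
        by (simp add: fact_n)
      also have "\<dots> = real_of_int (S1 n j) - real n * real_of_int (S1 n (Suc j))"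
        unfolding bernoulli_fps_power_Suc_nth_Suc IH0 IH1 nj
        by (simp add: algebra_simps)
      finally show ?thesis
        by (simp add: k S1_Suc_Suc i(1) del: power_Suc)
    qed
  qed
qed simp

section \<open>Bernoulli numbers of natural order and products of Stirling numbers\<close>

lemma bernoulli_num_of_nat: "bernoulli_num (real n) j = fact j * (bernoulli_fps ^ n) $ j"
  by (simp add: bernoulli_num_def bernoulli_poly_def fps_real_power_of_nat bernoulli_fps_nth_0)

text \<open>The form needed for one link of a chain: the drop \<open>j\<close> between the two
  arguments is the parameter, because it becomes a part of the composition. It also determines the
  sign, since 2k + j and j have the same parity.\<close>

lemma abs_S1_eq_bernoulli_num:
  assumes "1 \<le> k"
  shows "real_of_int \<bar>S1 (k + j) k\<bar> =
    (-1) ^ j * (fact (k + j - 1) / fact (k - 1)) * bernoulli_num (real (k + j)) j / fact j"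
proof -
  have "(-1 :: real) ^ (k + j + k) = (-1) ^ j"
    by (simp add: power_add mult_ac flip: power_mult_distrib)
  then show ?thesis
    using S1_eq_bernoulli_fps_nth[of k "k + j"] assms
    by (simp add: abs_S1 bernoulli_num_of_nat mult.assoc del: of_nat_add)
qed

text \<open>The shifted partial sums climb from \<open>k\<close> to \<open>n\<close>, with the step
  \<open>\<kappa> i\<close> at the i-th factor. Its first argument is \<open>n\<close> minus the
  parts after \<open>i\<close>, hence the order of the Bernoulli number. The quotients of factorials
  telescope to (n-1)!/(k-1)!, and the factors 1/\<open>fact (\<kappa> i)\<close> complete the
  multinomial coefficient.\<close>

lemma prod_abs_S1_partial_sums:
  fixes \<kappa> :: "nat \<Rightarrow> nat"
  assumes "1 \<le> k" and n: "n = k + (\<Sum>i=1..m. \<kappa> i)"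
  shows "(\<Prod>i=1..m. real_of_int \<bar>S1 (k + (\<Sum>j=1..i. \<kappa> j)) (k + (\<Sum>j=1..i-1. \<kappa> j))\<bar>) =
    (-1) ^ (\<Sum>i=1..m. \<kappa> i) * multinom m n k \<kappa> *
      (\<Prod>i=1..m. bernoulli_num (real n - (\<Sum>j=i+1..m. real (\<kappa> j))) (\<kappa> i))"
proof -
  define s where "s i = k + (\<Sum>j=1..i. \<kappa> j)" for i
  have s_step: "s i = s (i - 1) + \<kappa> i" if "i \<in> {1..m}" for i
    using that by (cases i) (auto simp: s_def)
  have s_tail: "real n - (\<Sum>j=i+1..m. real (\<kappa> j)) = real (s i)" if "i \<in> {1..m}" for i
  proof -
    have "(\<Sum>j=1..m. \<kappa> j) = (\<Sum>j=1..i. \<kappa> j) + (\<Sum>j=i+1..m. \<kappa> j)"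
      using that sum.ub_add_nat[of 1 i \<kappa> "m - i"] by simp
    then show ?thesis by (simp add: n s_def)
  qed
  have tele: "(\<Prod>i=1..p. fact (s i - 1) / fact (s (i - 1) - 1) :: real)
      = fact (s p - 1) / fact (s 0 - 1)" for p
    by (induction p) (simp_all add: prod.nat_ivl_Suc')
  have "(\<Prod>i=1..m. real_of_int \<bar>S1 (s i) (s (i - 1))\<bar>) =
      (\<Prod>i=1..m. (-1) ^ \<kappa> i * (fact (s i - 1) / fact (s (i - 1) - 1)) *
         bernoulli_num (real n - (\<Sum>j=i+1..m. real (\<kappa> j))) (\<kappa> i) / fact (\<kappa> i))"
  proof (rule prod.cong)
    fix i assume i: "i \<in> {1..m}"
    have "1 \<le> s (i - 1)" using \<open>1 \<le> k\<close> by (simp add: s_def)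
    from abs_S1_eq_bernoulli_num[OF this, of "\<kappa> i"]
    show "real_of_int \<bar>S1 (s i) (s (i - 1))\<bar> =
        (-1) ^ \<kappa> i * (fact (s i - 1) / fact (s (i - 1) - 1)) *
         bernoulli_num (real n - (\<Sum>j=i+1..m. real (\<kappa> j))) (\<kappa> i) / fact (\<kappa> i)"
      unfolding s_tail[OF i] s_step[OF i, symmetric] .
  qed simp
  also have "\<dots> = (\<Prod>i=1..m. (-1) ^ \<kappa> i)
      * (\<Prod>i=1..m. fact (s i - 1) / fact (s (i - 1) - 1))
      * (\<Prod>i=1..m. bernoulli_num (real n - (\<Sum>j=i+1..m. real (\<kappa> j))) (\<kappa> i))
      / (\<Prod>i=1..m. fact (\<kappa> i))"
    by (simp only: prod.distrib prod_dividef)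
  also have "(\<Prod>i=1..m. fact (s i - 1) / fact (s (i - 1) - 1) :: real)
      = fact (n - 1) / fact (k - 1)"
    unfolding tele by (simp add: s_def n)
  also have "(\<Prod>i=1..m. (-1 :: real) ^ \<kappa> i) = (-1) ^ (\<Sum>i=1..m. \<kappa> i)"
    by (simp add: power_sum)
  finally show ?thesis
    by (simp add: s_def multinom_def)
qed

text \<open>Reverses the product by i -> m - i, so that the chain is read upwards from
  \<open>k\<close> to \<open>n\<close> like the partial sums of a composition. For i in {1..m},
  \<open>m - (i - 1)\<close> is the successor of \<open>m - i\<close>.\<close>

lemma real_abs_S1_chain:
  "real_of_int \<bar>S1_chain m n k l\<bar> =
     (\<Prod>i=1..m. real_of_int \<bar>S1 ((l(0 := n, m := k)) (m - i)) ((l(0 := n, m := k)) (m - (i - 1)))\<bar>)"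
proof -
  define l' where "l' = l(0 := n, m := k)"
  have "real_of_int \<bar>S1_chain m n k l\<bar> = (\<Prod>i<m. real_of_int \<bar>S1 (l' i) (l' (Suc i))\<bar>)"
    by (simp add: S1_chain_def Let_def l'_def abs_prod)
  also have "\<dots> = (\<Prod>i=1..m. real_of_int \<bar>S1 (l' (m - i)) (l' (m - (i - 1)))\<bar>)"
    by (rule prod.reindex_bij_witness[of _ "\<lambda>i. m - i" "\<lambda>i. m - i"])
       (auto simp: Suc_diff_Suc)
  finally show ?thesis unfolding l'_def .
qed

section \<open>Bijection between weakly decreasing chains and weak compositions\<close>

theorem theorem1:
  fixes m n k :: nat
  assumes "m \<ge> 1" and "n \<ge> 1" and "1 \<le> k" and "k \<le> n"
  shows "(\<Sum>l \<in> {1..m-1} \<rightarrow>\<^sub>E {0..n}. real_of_int \<bar>S1_chain m n k l\<bar>) =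
         (\<Sum>\<kappa> \<in> weak_compositions m (n - k).
            (-1) ^ (\<Sum>i=1..m. \<kappa> i) * multinom m n k \<kappa> *
            (\<Prod>i=1..m. bernoulli_num (real n - (\<Sum>j=i+1..m. real (\<kappa> j))) (\<kappa> i)))"
proof -
  define e :: "(nat \<Rightarrow> nat) \<Rightarrow> nat \<Rightarrow> nat" where "e l = l(0 := n, m := k)" for l
  define T where
    "T = {l \<in> {1..m-1} \<rightarrow>\<^sub>E {0..n}. \<forall>i\<in>{1..m}. e l (m - (i - 1)) \<le> e l (m - i)}"
  define to_l :: "(nat \<Rightarrow> nat) \<Rightarrow> nat \<Rightarrow> nat"
    where "to_l \<kappa> = (\<lambda>i\<in>{1..m-1}. k + (\<Sum>j=1..m-i. \<kappa> j))" for \<kappa>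
  define to_k :: "(nat \<Rightarrow> nat) \<Rightarrow> nat \<Rightarrow> nat"
    where "to_k l = (\<lambda>i\<in>{1..m}. e l (m - i) - e l (m - (i - 1)))" for l
  \<comment> \<open>The formula for the interior entries also gives the endpoints: the empty sum
    yields \<open>k\<close> at position \<open>m\<close>, and the full sum n - k yields
    \<open>n\<close> at position 0. As \<open>m \<ge> 1\<close>, the two updates in \<open>e\<close>
    do not collide.\<close>
  have e_to_l: "e (to_l \<kappa>) (m - i) = k + (\<Sum>j=1..i. \<kappa> j)"
    if \<kappa>: "\<kappa> \<in> weak_compositions m (n - k)" and i: "i \<le> m" for \<kappa> i
  proof -
    consider "i = 0" | "i = m" | "0 < i" "i < m" using i by linarith
    then show ?thesis
    proof cases
      case 3
      then show ?thesis by (auto simp: e_def to_l_def)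
    qed (use \<kappa> assms in \<open>auto simp: e_def weak_compositions_def\<close>)
  qed
  \<comment> \<open>The increments telescope; membership in \<open>T\<close> ensures that no
    difference of natural numbers is truncated.\<close>
  have sum_to_k: "k + (\<Sum>j=1..i. to_k l j) = e l (m - i)" if "l \<in> T" "i \<le> m" for l i
    using that(2)
  proof (induction i)
    case 0
    show ?case by (simp add: e_def)
  next
    case (Suc i)
    have "e l (m - i) \<le> e l (m - Suc i)"
      using that(1) Suc.prems unfolding T_def by force
    then show ?case using Suc by (simp add: to_k_def)
  qed
  have "(\<Sum>l \<in> {1..m-1} \<rightarrow>\<^sub>E {0..n}. real_of_int \<bar>S1_chain m n k l\<bar>) =
      (\<Sum>l \<in> T. real_of_int \<bar>S1_chain m n k l\<bar>)"
  proof (rule sum.mono_neutral_right)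
    \<comment> \<open>Outside \<open>T\<close> some entry is smaller than its successor, and the
      corresponding factor is 0 by \<open>S1_eq_0\<close>.\<close>
    show "\<forall>l\<in>({1..m-1} \<rightarrow>\<^sub>E {0..n}) - T. real_of_int \<bar>S1_chain m n k l\<bar> = 0"
    proof
      fix l assume "l \<in> ({1..m-1} \<rightarrow>\<^sub>E {0..n}) - T"
      then obtain i where "i \<in> {1..m}" "e l (m - i) < e l (m - (i - 1))"
        by (auto simp: T_def not_le)
      then show "real_of_int \<bar>S1_chain m n k l\<bar> = 0"
        unfolding real_abs_S1_chain e_def[symmetric]
        by (intro prod_zero bexI[of _ i]) (simp_all add: S1_eq_0)
    qed
  qed (auto simp: T_def intro: finite_PiE)
  also have "\<dots> = (\<Sum>\<kappa> \<in> weak_compositions m (n - k).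
            (-1) ^ (\<Sum>i=1..m. \<kappa> i) * multinom m n k \<kappa> *
            (\<Prod>i=1..m. bernoulli_num (real n - (\<Sum>j=i+1..m. real (\<kappa> j))) (\<kappa> i)))"
  proof (rule sum.reindex_bij_witness[of _ to_l to_k])
    fix l assume l: "l \<in> T"
    show "to_l (to_k l) = l"
    proof (rule extensionalityI[of _ "{1..m-1}"])
      fix i assume i: "i \<in> {1..m-1}"
      then have "to_l (to_k l) i = e l (m - (m - i))"
        using sum_to_k[OF l, of "m - i"] by (simp add: to_l_def)
      then show "to_l (to_k l) i = l i" using i by (auto simp: e_def)
    qed (use l in \<open>auto simp: to_l_def T_def PiE_iff\<close>)
    have sum_l: "(\<Sum>i=1..m. to_k l i) = n - k"
      using sum_to_k[OF l, of m] assms by (auto simp: e_def)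
    then show mem: "to_k l \<in> weak_compositions m (n - k)"
      by (auto simp: weak_compositions_def to_k_def)
    have n: "n = k + (\<Sum>i=1..m. to_k l i)" using sum_l assms by simp
    have "(\<Prod>i=1..m. real_of_int
          \<bar>S1 (k + (\<Sum>j=1..i. to_k l j)) (k + (\<Sum>j=1..i-1. to_k l j))\<bar>)
        = real_of_int \<bar>S1_chain m n k l\<bar>"
      unfolding real_abs_S1_chain e_def[symmetric]
      by (intro prod.cong refl) (simp only: sum_to_k[OF l] atLeastAtMost_iff le_diff_conv trans_le_add1)
    then show "(-1) ^ (\<Sum>i=1..m. to_k l i) * multinom m n k (to_k l) *
        (\<Prod>i=1..m. bernoulli_num (real n - (\<Sum>j=i+1..m. real (to_k l j))) (to_k l i))
        = real_of_int \<bar>S1_chain m n k l\<bar>"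
      unfolding prod_abs_S1_partial_sums[OF \<open>1 \<le> k\<close> n] .
  next
    fix \<kappa> assume \<kappa>: "\<kappa> \<in> weak_compositions m (n - k)"
    have step: "e (to_l \<kappa>) (m - i) = e (to_l \<kappa>) (m - (i - 1)) + \<kappa> i" if "i \<in> {1..m}" for i
      using that e_to_l[OF \<kappa>, of i] e_to_l[OF \<kappa>, of "i - 1"] by (cases i) auto
    show "to_k (to_l \<kappa>) = \<kappa>"
      by (rule extensionalityI[of _ "{1..m}"])
         (use \<kappa> step in \<open>auto simp: to_k_def weak_compositions_def PiE_iff\<close>)
    \<comment> \<open>Shows that the entries of \<open>to_l \<kappa>\<close> stay in the summation
      range \<open>{0..n}\<close>.\<close>
    have "k + (\<Sum>j=1..m-i. \<kappa> j) \<le> n" for i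
    proof -
      have "(\<Sum>j=1..m-i. \<kappa> j) \<le> (\<Sum>j=1..m. \<kappa> j)" by (rule sum_mono2) auto
      then show ?thesis using \<kappa> assms by (simp add: weak_compositions_def)
    qed
    then show "to_l \<kappa> \<in> T"
      unfolding T_def using step by (auto simp: to_l_def)
  qed
  finally show ?thesis .
qed

end
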